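(* Let $S$ be a nonempty commutative semigroup, let $G$ be a nilpotent group of class $n$, and let $\bar d=(d_1,\ldots,d_n)\in\mathbb{Z}_*^n$ be a superadditive vector. Then the set of all polynomial maps $f:S\to G$ whose lc-degree $\hat d$ satisfies $\hat d\le\bar d$ forms a nilpotent subgroup of the group $G_p^S$ of all polynomial maps $S\to G$ under elementwise multiplication.
   Context: $\mathbb{Z}_*=\{-\infty\}\cup\{0,1,2,\ldots\}$, with $-\infty<m$, $-\infty+m=-\infty$ for all integers $m$, and $(-\infty)+(-\infty)=-\infty$. A vector $(d_1,\ldots,d_n)\in\mathbb{Z}_*^n$ is superadditive if $d_i\le d_j$ for all $i\le j$ and $d_i+d_j\le d_{i+j}$ for all $i,j\ge1$ with $i+j\le n$. The relation $\hat d\le\bar d$ between vectors means inequality in every component. Let $S$ be a nonempty commutative semigroup (written additively) and $G$ a group with identity $1_G$. A map $f:S\to G$ is a polynomial map of degree $-\infty$ if $f(s)=1_G$ for all $s$, and of degree $0$ if it is constant with value different from $1_G$. Thus degree $\le 0$ means constant. Inductively, for $d\in\{0,1,2,\dots\}$, $f$ is a polynomial map of degree $\le d+1$ if for every $s\in S$ both maps $L_s(f):t\mapsto f(s+t)f(t)^{-1}$ and $R_s(f):t\mapsto f(t)^{-1}f(s+t)$ from $S$ to $G$ are polynomial maps of degree $\le d$. The degree of a polynomial map is the least such $d\in\{-\infty,0,1,2,\dots\}$. A map is a polynomial map if it is a polynomial map of degree $\le d$ for some $d$. When $G$ is nilpotent, the polynomial maps $S\to G$ form a group $G_p^S$ under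 elementwise multiplication. The lower central series is $C^1G=G$, $C^{i+1}G=[C^iG,G]$. If $G$ is nilpotent of class $n$ and $f:S\to G$ is a polynomial map, its lc-degree is the vector $(d_1,\ldots,d_n)\in\mathbb{Z}_*^n$, where $d_i$ is the degree of the induced polynomial map $f\bmod C^{i+1}G:S\to G/C^{i+1}G$. *)

theory Defs
  imports "HOL-Algebra.Coset" "HOL-Algebra.Generated_Groups" "HOL-Algebra.Product_Groups"
begin

section \<open>Degrees\<close>

datatype degree_value = MInf | Fin nat

instantiation degree_value :: plus
begin

fun plus_degree_value :: "degree_value \<Rightarrow> degree_value \<Rightarrow> degree_value" where
  "Fin m + Fin n = Fin (m + n)"
| "MInf + y = MInf"
| "x + MInf = MInf"

instance ..

end

instantiation degree_value :: wellorder
begin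

fun less_eq_degree_value :: "degree_value \<Rightarrow> degree_value \<Rightarrow> bool" where
  "MInf \<le> y \<longleftrightarrow> True"
| "Fin m \<le> MInf \<longleftrightarrow> False"
| "Fin m \<le> Fin n \<longleftrightarrow> m \<le> n"

definition less_degree_value :: "degree_value \<Rightarrow> degree_value \<Rightarrow> bool" where
  "x < y \<longleftrightarrow> x \<le> y \<and> \<not> y \<le> (x :: degree_value)"

instance
proof
  fix x y z :: degree_value
  show "x < y \<longleftrightarrow> x \<le> y \<and> \<not> y \<le> x"
    by (simp add: less_degree_value_def)
  show "x \<le> x"
    by (cases x) simp_all
  show "x \<le> z" if "x \<le> y" "y \<le> z"
    using that by (cases x; cases y; cases z) simp_all
  show "x = y" if "x \<le> y" "y \<le> x"
    using that by (cases x; cases y) simp_all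
  show "x \<le> y \<or> y \<le> x"
    by (cases x; cases y) auto
next
  fix P :: "degree_value \<Rightarrow> bool" and a :: degree_value
  assume step: "\<And>x. (\<And>y. y < x \<Longrightarrow> P y) \<Longrightarrow> P x"
  have bot: "P MInf"
  proof (rule step)
    show "P y" if "y < MInf" for y
      using that by (cases y) (simp_all add: less_degree_value_def)
  qed
  have fin: "P (Fin n)" for n
  proof (induction n rule: less_induct)
    case (less n)
    show ?case
    proof (rule step)
      show "P y" if "y < Fin n" for y
        using that bot less by (cases y) (simp_all add: less_degree_value_def)
    qed
  qed
  show "P a"
    using bot fin by (cases a) simp_all
qed

end

text \<open>
  Vectors of length \<open>n\<close> are functions on \<open>nat\<close> of which only the values at the
  indices \<open>1, \<dots>, n\<close> are relevant.
\<close>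

definition superadditive :: "nat \<Rightarrow> (nat \<Rightarrow> degree_value) \<Rightarrow> bool" where
  "superadditive n d \<longleftrightarrow>
     (\<forall>i j. 1 \<le> i \<and> i \<le> j \<and> j \<le> n \<longrightarrow> d i \<le> d j) \<and>
     (\<forall>i j. 1 \<le> i \<and> 1 \<le> j \<and> i + j \<le> n \<longrightarrow> d i + d j \<le> d (i + j))"

definition vector_le :: "nat \<Rightarrow> (nat \<Rightarrow> degree_value) \<Rightarrow> (nat \<Rightarrow> degree_value) \<Rightarrow> bool" where
  "vector_le n d e \<longleftrightarrow> (\<forall>i\<in>{1..n}. d i \<le> e i)"


section \<open>Nilpotent groups\<close>

definition commutator_subgroup ::
    "('g, 'm) monoid_scheme \<Rightarrow> 'g set \<Rightarrow> 'g set \<Rightarrow> 'g set" where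
  "commutator_subgroup G H K =
     generate G (\<Union>h\<in>H. \<Union>k\<in>K. {h \<otimes>\<^bsub>G\<^esub> k \<otimes>\<^bsub>G\<^esub> inv\<^bsub>G\<^esub> h \<otimes>\<^bsub>G\<^esub> inv\<^bsub>G\<^esub> k})"

text \<open>
  The series is indexed from 1, so that \<open>lower_central G 1\<close> is \<open>carrier G\<close> and
  \<open>lower_central G (i + 1) = [lower_central G i, G]\<close> for \<open>i \<ge> 1\<close>; the value at 0
  has no meaning.
\<close>

definition lower_central :: "('g, 'm) monoid_scheme \<Rightarrow> nat \<Rightarrow> 'g set" where
  "lower_central G i = ((\<lambda>H. commutator_subgroup G H (carrier G)) ^^ (i - 1)) (carrier G)"

definition nilpotent_group :: "('g, 'm) monoid_scheme \<Rightarrow> bool" where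
  "nilpotent_group G \<longleftrightarrow> group G \<and> (\<exists>n. lower_central G (n + 1) = {\<one>\<^bsub>G\<^esub>})"

definition nilpotency_class :: "('g, 'm) monoid_scheme \<Rightarrow> nat" where
  "nilpotency_class G = (LEAST n. lower_central G (n + 1) = {\<one>\<^bsub>G\<^esub>})"


section \<open>Polynomial maps\<close>

locale comm_semigroup_on =
  fixes S :: "'s set" and add :: "'s \<Rightarrow> 's \<Rightarrow> 's"
  assumes nonempty: "S \<noteq> {}"
    and closed: "\<lbrakk>s \<in> S; t \<in> S\<rbrakk> \<Longrightarrow> add s t \<in> S"
    and assoc: "\<lbrakk>r \<in> S; s \<in> S; t \<in> S\<rbrakk> \<Longrightarrow> add (add r s) t = add r (add s t)"
    and commute: "\<lbrakk>s \<in> S; t \<in> S\<rbrakk> \<Longrightarrow> add s t = add t s"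

definition left_diff ::
    "'s set \<Rightarrow> ('s \<Rightarrow> 's \<Rightarrow> 's) \<Rightarrow> ('g, 'm) monoid_scheme \<Rightarrow> 's \<Rightarrow> ('s \<Rightarrow> 'g) \<Rightarrow> 's \<Rightarrow> 'g" where
  "left_diff S add G s f = (\<lambda>t\<in>S. f (add s t) \<otimes>\<^bsub>G\<^esub> inv\<^bsub>G\<^esub> (f t))"

definition right_diff ::
    "'s set \<Rightarrow> ('s \<Rightarrow> 's \<Rightarrow> 's) \<Rightarrow> ('g, 'm) monoid_scheme \<Rightarrow> 's \<Rightarrow> ('s \<Rightarrow> 'g) \<Rightarrow> 's \<Rightarrow> 'g" where
  "right_diff S add G s f = (\<lambda>t\<in>S. inv\<^bsub>G\<^esub> (f t) \<otimes>\<^bsub>G\<^esub> f (add s t))"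

text \<open>
  Maps from \<open>S\<close> to \<open>G\<close> are extensional functions, as in \<^const>\<open>product_group\<close>, so that
  equality of maps is equality on \<open>S\<close>.
\<close>

function poly_degree_le ::
    "'s set \<Rightarrow> ('s \<Rightarrow> 's \<Rightarrow> 's) \<Rightarrow> ('g, 'm) monoid_scheme \<Rightarrow> degree_value \<Rightarrow> ('s \<Rightarrow> 'g) \<Rightarrow> bool" where
  "poly_degree_le S add G MInf f \<longleftrightarrow>
     f \<in> S \<rightarrow>\<^sub>E carrier G \<and> (\<forall>s\<in>S. f s = \<one>\<^bsub>G\<^esub>)"
| "poly_degree_le S add G (Fin 0) f \<longleftrightarrow>
     f \<in> S \<rightarrow>\<^sub>E carrier G \<and> (\<exists>c\<in>carrier G. \<forall>s\<in>S. f s = c)"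
| "poly_degree_le S add G (Fin (Suc d)) f \<longleftrightarrow>
     f \<in> S \<rightarrow>\<^sub>E carrier G \<and>
     (\<forall>s\<in>S. poly_degree_le S add G (Fin d) (left_diff S add G s f) \<and>
            poly_degree_le S add G (Fin d) (right_diff S add G s f))"
  by pat_completeness auto
termination
  by (relation "measure (\<lambda>(S, add, G, d, f). case d of MInf \<Rightarrow> 0 | Fin n \<Rightarrow> n)") auto

definition polynomial_map ::
    "'s set \<Rightarrow> ('s \<Rightarrow> 's \<Rightarrow> 's) \<Rightarrow> ('g, 'm) monoid_scheme \<Rightarrow> ('s \<Rightarrow> 'g) \<Rightarrow> bool" where
  "polynomial_map S add G f \<longleftrightarrow> (\<exists>d. poly_degree_le S add G d f)"

definition poly_degree ::
    "'s set \<Rightarrow> ('s \<Rightarrow> 's \<Rightarrow> 's) \<Rightarrow> ('g, 'm) monoid_scheme \<Rightarrow> ('s \<Rightarrow> 'g) \<Rightarrow> degree_value" where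
  "poly_degree S add G f = (LEAST d. poly_degree_le S add G d f)"

definition polynomial_map_group ::
    "'s set \<Rightarrow> ('s \<Rightarrow> 's \<Rightarrow> 's) \<Rightarrow> ('g, 'm) monoid_scheme \<Rightarrow> ('s \<Rightarrow> 'g) monoid" where
  "polynomial_map_group S add G =
     (product_group S (\<lambda>_. G))\<lparr>carrier := {f. polynomial_map S add G f}\<rparr>"

definition map_mod :: "'s set \<Rightarrow> ('g, 'm) monoid_scheme \<Rightarrow> 'g set \<Rightarrow> ('s \<Rightarrow> 'g) \<Rightarrow> 's \<Rightarrow> 'g set" where
  "map_mod S G N f = (\<lambda>s\<in>S. N #>\<^bsub>G\<^esub> f s)"

definition lc_degree ::
    "'s set \<Rightarrow> ('s \<Rightarrow> 's \<Rightarrow> 's) \<Rightarrow> ('g, 'm) monoid_scheme \<Rightarrow> ('s \<Rightarrow> 'g) \<Rightarrow> nat \<Rightarrow> degree_value" where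
  "lc_degree S add G f i =
     poly_degree S add (G Mod lower_central G (i + 1)) (map_mod S G (lower_central G (i + 1)) f)"

end

theory Submission
  imports Defs
begin

text \<open>
  The bound on the lc-degree is the statement that a map is polynomial with respect to a
  filtration of \<open>G\<close>, and the theorem is then an instance of the Lazard--Leibman theorem on
  such maps.

  Write \<open>C\<^sup>i\<close> for the lower central series. The map \<open>f mod C\<^bsup>i+1\<^esup>\<close> has degree at most \<open>d\<^sub>i\<close>
  exactly if every \<open>k\<close>-fold difference of \<open>f\<close> with \<open>k > d\<^sub>i\<close> takes its values in \<open>C\<^bsup>i+1\<^esup>\<close>
  (\<open>poly_degree_le_mod_iff\<close>). So all the bounds together say that the \<open>k\<close>-fold differences
  of \<open>f\<close> lie in \<open>F\<^sub>k\<close>, the intersection of the groups \<open>C\<^bsup>i+1\<^esup>\<close> with \<open>d\<^sub>i < k\<close>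
  (\<open>bounded_lc_degree_iff\<close>). Superadditivity of \<open>d\<close>, combined with
  \<open>[C\<^sup>a, C\<^sup>b] \<subseteq> C\<^bsup>a+b\<^esup>\<close>, is what makes the decreasing sequence \<open>F\<close> a filtration,
  that is, \<open>[F\<^sub>k, F\<^sub>l] \<subseteq> F\<^bsub>k+l\<^esub>\<close> (\<open>lc_filtration_commutator\<close>).

  For any filtration, the maps whose \<open>k\<close>-fold differences lie in \<open>F\<^sub>k\<close> form a group
  (\<open>Filtered_subgroup_commutator\<close>). The difference of a product is
  \<open>D(f g) = D f [f, D g] D g\<close>, so closure under products needs control of commutators, which
  is why one proves at the same time that commutators add up the filtration indices. The
  induction is on the number of differences that are looked at; each difference of a product,
  inverse or commutator is a word in maps about which one difference less has to be known.

  A polynomial map of degree at most \<open>D\<close> satisfies the bounds of the superadditive vector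
  \<open>(D, 2D, \<dots>, nD)\<close>, so the group of all polynomial maps is the increasing union of the groups
  for these vectors. Nilpotency is inherited from the power \<open>G\<^sup>S\<close>: evaluation at a point
  is a homomorphism to \<open>G\<close> and maps the lower central series into that of \<open>G\<close>.
\<close>

section \<open>Commutator identities\<close>

definition commutator :: "('g, 'm) monoid_scheme \<Rightarrow> 'g \<Rightarrow> 'g \<Rightarrow> 'g" where
  "commutator G x y = x \<otimes>\<^bsub>G\<^esub> y \<otimes>\<^bsub>G\<^esub> inv\<^bsub>G\<^esub> x \<otimes>\<^bsub>G\<^esub> inv\<^bsub>G\<^esub> y"

context group
begin

lemma mult_inv_cancel_left:
  assumes "x \<in> carrier G" "y \<in> carrier G"
  shows "x \<otimes> (inv x \<otimes> y) = y" and "inv x \<otimes> (x \<otimes> y) = y"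
  using assms by (simp_all flip: m_assoc)

lemma commutator_closed:
  "\<lbrakk>x \<in> carrier G; y \<in> carrier G\<rbrakk> \<Longrightarrow> commutator G x y \<in> carrier G"
  by (simp add: commutator_def)

text \<open>
  These rules bring a group word to a right-associated reduced form, which decides the
  identities below.
\<close>

lemmas word_simps = commutator_def m_assoc inv_mult_group mult_inv_cancel_left

lemma inv_commutator:
  assumes "x \<in> carrier G" "y \<in> carrier G"
  shows "inv (commutator G x y) = commutator G y x"
  using assms by (simp add: word_simps)

lemma conjugate_eq_commutator_mult:
  assumes "x \<in> carrier G" "y \<in> carrier G"
  shows "x \<otimes> y \<otimes> inv x = commutator G x y \<otimes> y"
  using assms by (simp add: word_simps)

lemma commutator_mult_right:
  assumes "x \<in> carrier G" "y \<in> carrier G" "z \<in> carrier G"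
  shows "commutator G x (y \<otimes> z) = commutator G x y \<otimes> (y \<otimes> commutator G x z \<otimes> inv y)"
  using assms by (simp add: word_simps)

lemma commutator_inv_right:
  assumes "x \<in> carrier G" "y \<in> carrier G"
  shows "commutator G x (inv y) = inv y \<otimes> inv (commutator G x y) \<otimes> y"
  using assms by (simp add: word_simps)

lemma hall_witt_identity:
  assumes "x \<in> carrier G" "y \<in> carrier G" "z \<in> carrier G"
  shows "commutator G (commutator G x y) (y \<otimes> z \<otimes> inv y) \<otimes>
         commutator G (commutator G y z) (z \<otimes> x \<otimes> inv z) \<otimes>
         commutator G (commutator G z x) (x \<otimes> y \<otimes> inv x) = \<one>"
  using assms by (simp add: word_simps)

text \<open>
  In the next four lemmas the primed letters will be translates \<open>t \<mapsto> f (s + t)\<close> of the unprimed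
  maps \<open>f\<close>, so that \<open>x' \<otimes> inv x\<close> is a left difference. Each right-hand side is a word
  in differences, and in commutators and conjugates with a difference inside.
\<close>

lemma left_quotient_mult:
  assumes "x \<in> carrier G" "y \<in> carrier G" "x' \<in> carrier G" "y' \<in> carrier G"
  shows "(x' \<otimes> y') \<otimes> inv (x \<otimes> y) =
         (x' \<otimes> inv x) \<otimes> commutator G x (y' \<otimes> inv y) \<otimes> (y' \<otimes> inv y)"
  using assms by (simp add: word_simps)

lemma left_quotient_inv:
  assumes "x \<in> carrier G" "x' \<in> carrier G"
  shows "inv x' \<otimes> inv (inv x) =
         commutator G (inv x) (inv (x' \<otimes> inv x)) \<otimes> inv (x' \<otimes> inv x)"
  using assms by (simp add: word_simps)

lemma right_quotient_eq:
  assumes "x \<in> carrier G" "x' \<in> carrier G"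
  shows "inv x \<otimes> x' = commutator G (inv x) (x' \<otimes> inv x) \<otimes> (x' \<otimes> inv x)"
  using assms by (simp add: word_simps)

text \<open>
  The commutator \<open>c\<close> occurs on the right only inside commutators and as a conjugating element.
  When \<open>c\<close> itself is the map whose differences are sought, it is therefore enough to
  know one difference less of \<open>c\<close>.
\<close>

lemma left_quotient_commutator:
  assumes "x \<in> carrier G" "y \<in> carrier G" "x' \<in> carrier G" "y' \<in> carrier G"
    and "a = x' \<otimes> inv x" "b = y' \<otimes> inv y" "c = commutator G x y"
  shows "commutator G x' y' \<otimes> inv c =
         (a \<otimes> commutator G x b \<otimes> inv a) \<otimes> commutator G (a \<otimes> b) c \<otimes>
         (c \<otimes> (commutator G a b \<otimes> (b \<otimes> commutator G a y \<otimes> inv b)) \<otimes> inv c)"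
  using assms by (simp add: word_simps)

end


section \<open>The lower central series\<close>

context group
begin

text \<open>
  Since \<^term>\<open>lower_central G 0\<close> has no meaning, facts about the series are stated for indices of
  the form \<^term>\<open>Suc i\<close>.
\<close>

lemma lower_central_1: "lower_central G (Suc 0) = carrier G"
  by (simp add: lower_central_def)

lemma lower_central_Suc:
  "lower_central G (Suc (Suc i)) =
   generate G (\<Union>h\<in>lower_central G (Suc i). \<Union>k\<in>carrier G. {commutator G h k})"
  by (simp add: lower_central_def commutator_subgroup_def commutator_def)

lemma lower_central_normal: "lower_central G (Suc i) \<lhd> G"
proof (induction i)
  case 0
  show ?case
    by (simp add: lower_central_1 normal_inv_iff subgroup_self)
next
  case (Suc i)
  interpret N: normal "lower_central G (Suc i)" G by (rule Suc.IH)
  show ?case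
    unfolding lower_central_Suc
  proof (rule normal_generateI)
    show "(\<Union>h\<in>lower_central G (Suc i). \<Union>k\<in>carrier G. {commutator G h k}) \<subseteq> carrier G"
      by (auto intro: commutator_closed)
  next
    fix c g
    assume "c \<in> (\<Union>h\<in>lower_central G (Suc i). \<Union>k\<in>carrier G. {commutator G h k})"
      and g: "g \<in> carrier G"
    then obtain h k where hk: "h \<in> lower_central G (Suc i)" "k \<in> carrier G" "c = commutator G h k"
      by auto
    have "g \<otimes> c \<otimes> inv g = commutator G (g \<otimes> h \<otimes> inv g) (g \<otimes> k \<otimes> inv g)"
      using hk g N.mem_carrier[of h] by (simp add: word_simps)
    then show "g \<otimes> c \<otimes> inv g \<in> (\<Union>h\<in>lower_central G (Suc i). \<Union>k\<in>carrier G. {commutator G h k})"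
      using N.inv_op_closed2[OF g hk(1)] hk(2) g by blast
  qed
qed

lemma lower_central_subgroup: "subgroup (lower_central G (Suc i)) G"
  using lower_central_normal normal_imp_subgroup by blast

lemma lower_central_subset: "lower_central G (Suc i) \<subseteq> carrier G"
  using lower_central_subgroup subgroup.subset by blast

lemma commutator_in_lower_central_Suc:
  assumes "x \<in> lower_central G (Suc i)" "y \<in> carrier G"
  shows "commutator G x y \<in> lower_central G (Suc (Suc i))"
  unfolding lower_central_Suc using assms by (blast intro: generate.incl)

lemma lower_central_Suc_subset: "lower_central G (Suc (Suc i)) \<subseteq> lower_central G (Suc i)"
  unfolding lower_central_Suc
proof (rule generate_subgroup_incl[OF _ lower_central_subgroup])
  interpret N: normal "lower_central G (Suc i)" G by (rule lower_central_normal)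
  have "commutator G h k \<in> lower_central G (Suc i)"
    if "h \<in> lower_central G (Suc i)" "k \<in> carrier G" for h k
  proof -
    have "commutator G h k = h \<otimes> (k \<otimes> inv h \<otimes> inv k)"
      using that N.mem_carrier by (simp add: word_simps)
    then show ?thesis
      using that N.inv_op_closed2 by simp
  qed
  then show "(\<Union>h\<in>lower_central G (Suc i). \<Union>k\<in>carrier G. {commutator G h k})
      \<subseteq> lower_central G (Suc i)"
    by blast
qed

lemma lower_central_antimono: "i \<le> j \<Longrightarrow> lower_central G (Suc j) \<subseteq> lower_central G (Suc i)"
  by (rule lift_Suc_antimono_le[where f = "\<lambda>i. lower_central G (Suc i)"])
     (rule lower_central_Suc_subset)

text \<open>
  This reduces a commutator inclusion \<open>[A, B] \<subseteq> N\<close> to generators of \<open>B\<close>.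
\<close>

lemma subgroup_commutator_into_normal:
  assumes "A \<subseteq> carrier G" "N \<lhd> G"
  shows "subgroup {y \<in> carrier G. \<forall>x\<in>A. commutator G x y \<in> N} G"
proof -
  interpret N: normal N G by fact
  show ?thesis
  proof (rule subgroupI)
    have "\<one> \<in> {y \<in> carrier G. \<forall>x\<in>A. commutator G x y \<in> N}"
      using assms(1) by (auto simp: commutator_def subset_iff)
    then show "{y \<in> carrier G. \<forall>x\<in>A. commutator G x y \<in> N} \<noteq> {}" by blast
  next
    fix y assume "y \<in> {y \<in> carrier G. \<forall>x\<in>A. commutator G x y \<in> N}"
    then show "inv y \<in> {y \<in> carrier G. \<forall>x\<in>A. commutator G x y \<in> N}"
      using assms(1) by (auto simp: commutator_inv_right subset_iff N.inv_op_closed1)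
  next
    fix y z
    assume "y \<in> {y \<in> carrier G. \<forall>x\<in>A. commutator G x y \<in> N}"
      and "z \<in> {y \<in> carrier G. \<forall>x\<in>A. commutator G x y \<in> N}"
    then show "y \<otimes> z \<in> {y \<in> carrier G. \<forall>x\<in>A. commutator G x y \<in> N}"
      using assms(1) by (auto simp: commutator_mult_right subset_iff N.inv_op_closed2)
  qed auto
qed

text \<open>
  The three subgroups argument. In the induction step on the second index, \<open>y\<close> may be taken to be
  a generator \<open>[u, v]\<close> with \<open>u\<close> one term higher up in the series. Up to conjugation, the
  Hall--Witt identity expresses \<open>[x, [u, v]]\<close> by \<open>[[v, x], u]\<close> and \<open>[[x, u], v]\<close>, in which the
  induction hypothesis controls the commutators with \<open>u\<close>.
\<close>

lemma commutator_lower_central: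
  assumes "x \<in> lower_central G (Suc i)" "y \<in> lower_central G (Suc j)"
  shows "commutator G x y \<in> lower_central G (Suc (Suc (i + j)))"
  using assms
proof (induction j arbitrary: i x y)
  case 0
  then show ?case
    by (simp add: lower_central_1 commutator_in_lower_central_Suc)
next
  case (Suc j)
  let ?C = "\<lambda>i. lower_central G (Suc i)"
  let ?N = "?C (Suc (i + Suc j))"
  interpret N: normal ?N G by (rule lower_central_normal)
  interpret Ci: normal "?C i" G by (rule lower_central_normal)
  interpret Cj: normal "?C j" G by (rule lower_central_normal)
  have gen: "commutator G x (commutator G u v) \<in> ?N"
    if x: "x \<in> ?C i" and u: "u \<in> ?C j" and v: "v \<in> carrier G" for x u v
  proof -
    \<comment> \<open>The identity contains a conjugate of its third entry; this choice makes it \<open>x\<close>.\<close>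
    define z where "z = inv v \<otimes> x \<otimes> v"
    have z: "z \<in> ?C i" unfolding z_def by (rule Ci.inv_op_closed1[OF v x])
    note car = Ci.mem_carrier[OF x] Ci.mem_carrier[OF z] Cj.mem_carrier[OF u] v
    have vz: "v \<otimes> z \<otimes> inv v = x" unfolding z_def using car by (simp add: word_simps)
    define p where "p = commutator G (commutator G u v) x"
    define q where "q = commutator G (commutator G v z) (z \<otimes> u \<otimes> inv z)"
    define r where "r = commutator G (commutator G z u) (u \<otimes> v \<otimes> inv u)"
    have pqr: "p \<in> carrier G" "q \<in> carrier G" "r \<in> carrier G"
      unfolding p_def q_def r_def using car by (auto intro!: commutator_closed)
    have "p \<otimes> q \<otimes> r = \<one>"
      using hall_witt_identity[of u v z] car by (simp add: vz p_def q_def r_def)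
    then have pqr_eq: "inv p = q \<otimes> r"
      using pqr by (metis inv_closed inv_equality inv_inv m_assoc m_closed)
    have "commutator G v z \<in> ?C (Suc i)"
      using subgroup.m_inv_closed[OF lower_central_subgroup
          commutator_in_lower_central_Suc[OF z v]] car
      by (simp add: inv_commutator)
    moreover have "z \<otimes> u \<otimes> inv z \<in> ?C j"
      using Cj.inv_op_closed2 u car by blast
    ultimately have "q \<in> ?N"
      unfolding q_def using Suc.IH[of _ "Suc i"] by simp
    moreover have "commutator G z u \<in> ?C (Suc (i + j))"
      using Suc.IH[OF z u] .
    then have "r \<in> ?N"
      unfolding r_def using car by (simp add: commutator_in_lower_central_Suc)
    ultimately have "inv p \<in> ?N"
      unfolding pqr_eq by (rule N.m_closed)
    then show ?thesis
      using car by (simp add: p_def inv_commutator commutator_closed)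
  qed
  let ?Y = "{y \<in> carrier G. \<forall>x\<in>?C i. commutator G x y \<in> ?N}"
  have "?C (Suc j) \<subseteq> ?Y"
    unfolding lower_central_Suc[of j]
  proof (rule generate_subgroup_incl)
    show "subgroup ?Y G"
      by (rule subgroup_commutator_into_normal[OF Ci.subset N.normal_axioms])
    show "(\<Union>h\<in>?C j. \<Union>k\<in>carrier G. {commutator G h k}) \<subseteq> ?Y"
      using gen commutator_closed Cj.mem_carrier by blast
  qed
  with Suc.prems show ?case
    by auto
qed

end


section \<open>Maps whose differences lie in a filtration\<close>

text \<open>
  For \<open>k \<le> K\<close> all \<open>k\<close>-fold differences of \<open>f\<close> lie in \<^term>\<open>F (i + k)\<close>. The height \<open>K\<close>
  truncates the condition and makes induction possible; the condition of interest is the one for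
  all \<open>K\<close>.
\<close>

primrec differences_in ::
    "'s set \<Rightarrow> ('s \<Rightarrow> 's \<Rightarrow> 's) \<Rightarrow> ('g, 'm) monoid_scheme \<Rightarrow> (nat \<Rightarrow> 'g set) \<Rightarrow> nat \<Rightarrow> nat \<Rightarrow>
     ('s \<Rightarrow> 'g) \<Rightarrow> bool" where
  "differences_in S add G F 0 i f \<longleftrightarrow> f \<in> S \<rightarrow>\<^sub>E F i"
| "differences_in S add G F (Suc K) i f \<longleftrightarrow>
     f \<in> S \<rightarrow>\<^sub>E F i \<and>
     (\<forall>s\<in>S. differences_in S add G F K (Suc i) (left_diff S add G s f) \<and>
            differences_in S add G F K (Suc i) (right_diff S add G s f))"

lemma differences_in_PiE: "differences_in S add G F K i f \<Longrightarrow> f \<in> S \<rightarrow>\<^sub>E F i"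
  by (cases K) simp_all

lemma differences_in_Suc_imp:
  "differences_in S add G F (Suc K) i f \<Longrightarrow> differences_in S add G F K i f"
proof (induction K arbitrary: i f)
  case 0
  then show ?case by simp
next
  case (Suc K)
  then show ?case
    unfolding differences_in.simps(2)[of S add G F "Suc K"] differences_in.simps(2)[of S add G F K]
    by blast
qed

lemma differences_in_mono:
  assumes "\<And>k. i \<le> k \<Longrightarrow> F k \<subseteq> F' k" "differences_in S add G F K i f"
  shows "differences_in S add G F' K i f"
  using assms
proof (induction K arbitrary: i f)
  case 0
  then show ?case by (auto simp: PiE_iff)
next
  case (Suc K)
  have "f \<in> S \<rightarrow>\<^sub>E F' i"
    using Suc.prems(1)[of i] Suc.prems(2) by (auto simp: PiE_iff)
  moreover have "differences_in S add G F K (Suc i) g \<Longrightarrow> differences_in S add G F' K (Suc i) g" for g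
    using Suc.IH[of "Suc i" g] Suc.prems(1) by simp
  ultimately show ?case
    using Suc.prems(2) by auto
qed

lemma differences_in_Suc_index:
  "differences_in S add G F K (Suc i) f \<longleftrightarrow> differences_in S add G (\<lambda>k. F (Suc k)) K i f"
  by (induction K arbitrary: i f) simp_all

lemma differences_in_INT:
  assumes "I \<noteq> {}"
  shows "differences_in S add G (\<lambda>k. \<Inter>j\<in>I. F j k) K i f \<longleftrightarrow>
         (\<forall>j\<in>I. differences_in S add G (F j) K i f)"
proof (induction K arbitrary: i f)
  case 0
  show ?case using assms by (auto simp: PiE_iff)
next
  case (Suc K)
  have "f \<in> S \<rightarrow>\<^sub>E (\<Inter>j\<in>I. F j i) \<longleftrightarrow> (\<forall>j\<in>I. f \<in> S \<rightarrow>\<^sub>E F j i)"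
    using assms by (auto simp: PiE_iff)
  then show ?case
    by (auto simp: Suc)
qed

lemma all_differences_in_iff:
  "(\<forall>K. differences_in S add G F K i f) \<longleftrightarrow>
   f \<in> S \<rightarrow>\<^sub>E F i \<and>
   (\<forall>s\<in>S. (\<forall>K. differences_in S add G F K (Suc i) (left_diff S add G s f)) \<and>
          (\<forall>K. differences_in S add G F K (Suc i) (right_diff S add G s f)))"
  (is "?L \<longleftrightarrow> ?R")
proof
  assume L: ?L
  then have "differences_in S add G F (Suc K) i f" for K by blast
  then show ?R by auto
next
  assume R: ?R
  show ?L
  proof
    fix K show "differences_in S add G F K i f"
      using R by (cases K) auto
  qed
qed

text \<open>
  \<^term>\<open>F 0\<close> may be smaller than the carrier, and \<^term>\<open>F 1\<close> may be smaller than \<^term>\<open>F 0\<close>;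
  both can happen for the filtration of a vector with entries \<open>-\<infinity>\<close> or \<open>0\<close>.
\<close>

locale filtration = group G for G (structure) +
  fixes F :: "nat \<Rightarrow> 'a set"
  assumes subgroup_F: "subgroup (F i) G"
    and F_Suc_subset: "F (Suc i) \<subseteq> F i"
    and commutator_F: "\<lbrakk>x \<in> F i; y \<in> F j\<rbrakk> \<Longrightarrow> commutator G x y \<in> F (i + j)"

locale filtered_maps = filtration G F + comm_semigroup_on S add
  for G (structure) and F and S and add
begin

text \<open>
  Naming the product group keeps the simplifier from unfolding its operations pointwise, so that
  the word identities above apply to maps as elements of a group on which the shifts act by
  endomorphisms.
\<close>

definition "Maps = product_group S (\<lambda>_. G)"

definition "shift s f = (\<lambda>t\<in>S. f (add s t))"

definition "Filtered K i = {f. differences_in S add G F K i f}"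

sublocale Maps: group Maps
  by (simp add: Maps_def)

lemma F_subset: "F i \<subseteq> carrier G"
  by (rule subgroup.subset[OF subgroup_F])

lemma shift_closed:
  assumes "f \<in> carrier Maps" "s \<in> S"
  shows "shift s f \<in> carrier Maps"
  using assms by (auto simp: Maps_def shift_def PiE_iff closed)

lemma shift_mult:
  assumes "s \<in> S"
  shows "shift s (f \<otimes>\<^bsub>Maps\<^esub> g) = shift s f \<otimes>\<^bsub>Maps\<^esub> shift s g"
  using assms by (auto simp: Maps_def shift_def closed)

lemma shift_inv:
  assumes "f \<in> carrier Maps" "s \<in> S"
  shows "shift s (inv\<^bsub>Maps\<^esub> f) = inv\<^bsub>Maps\<^esub> (shift s f)"
  using assms shift_closed[OF assms]
  by (auto simp: Maps_def shift_def closed)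

lemma shift_commutator:
  assumes "f \<in> carrier Maps" "g \<in> carrier Maps" "s \<in> S"
  shows "shift s (commutator Maps f g) = commutator Maps (shift s f) (shift s g)"
  using assms by (simp add: commutator_def shift_mult shift_inv)

lemma left_diff_eq:
  assumes "f \<in> carrier Maps"
  shows "left_diff S add G s f = shift s f \<otimes>\<^bsub>Maps\<^esub> inv\<^bsub>Maps\<^esub> f"
  using assms by (auto simp: Maps_def shift_def left_diff_def)

lemma right_diff_eq:
  assumes "f \<in> carrier Maps"
  shows "right_diff S add G s f = inv\<^bsub>Maps\<^esub> f \<otimes>\<^bsub>Maps\<^esub> shift s f"
  using assms by (auto simp: Maps_def shift_def right_diff_def)

lemma Filtered_subset: "Filtered K i \<subseteq> carrier Maps"
proof
  fix f assume "f \<in> Filtered K i"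
  then have "f \<in> S \<rightarrow>\<^sub>E F i"
    unfolding Filtered_def using differences_in_PiE by blast
  then show "f \<in> carrier Maps"
    using F_subset by (auto simp: Maps_def PiE_iff)
qed

lemma Filtered_Suc_height: "Filtered (Suc K) i \<subseteq> Filtered K i"
  using differences_in_Suc_imp[of S add G F K i] by (auto simp: Filtered_def simp del: differences_in.simps)

lemma Filtered_Suc_index: "Filtered K (Suc i) \<subseteq> Filtered K i"
proof
  fix f assume "f \<in> Filtered K (Suc i)"
  then have "differences_in S add G (\<lambda>k. F (Suc k)) K i f"
    by (simp add: Filtered_def differences_in_Suc_index)
  then show "f \<in> Filtered K i"
    using differences_in_mono[of i "\<lambda>k. F (Suc k)" F] F_Suc_subset by (simp add: Filtered_def)
qed

lemma Filtered_antimono: "i \<le> j \<Longrightarrow> Filtered K j \<subseteq> Filtered K i"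
  by (rule lift_Suc_antimono_le[where f = "Filtered K"]) (rule Filtered_Suc_index)

lemma Filtered_SucD:
  assumes "f \<in> Filtered (Suc K) i" "s \<in> S"
  shows "shift s f \<otimes>\<^bsub>Maps\<^esub> inv\<^bsub>Maps\<^esub> f \<in> Filtered K (Suc i)"
proof -
  have "f \<in> carrier Maps"
    using assms Filtered_subset by blast
  with assms show ?thesis
    using left_diff_eq[of f s, symmetric] by (auto simp: Filtered_def)
qed

text \<open>
  The Lazard--Leibman theorem. Both parts are proved together by induction on the height \<open>K\<close>: at
  height \<open>Suc K\<close> only differences have to be examined, and these are words in elements
  of the groups of height \<open>K\<close>.
\<close>

theorem Filtered_subgroup_commutator:
  "(\<forall>i. subgroup (Filtered K i) Maps) \<and>
   (\<forall>i j. \<forall>f\<in>Filtered K i. \<forall>g\<in>Filtered K j. commutator Maps f g \<in> Filtered K (i + j))"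
proof (induction K)
  case 0
  have "Filtered 0 i = (S \<rightarrow>\<^sub>E F i)" for i
    by (auto simp: Filtered_def)
  moreover have "subgroup (S \<rightarrow>\<^sub>E F i) Maps" for i
    by (simp add: Maps_def PiE_subgroup_product_group subgroup_F)
  moreover have "commutator Maps f g \<in> S \<rightarrow>\<^sub>E F (i + j)"
    if f: "f \<in> S \<rightarrow>\<^sub>E F i" and g: "g \<in> S \<rightarrow>\<^sub>E F j" for f g i j
  proof -
    have "f \<in> carrier Maps" "g \<in> carrier Maps"
      using that F_subset by (fastforce simp: Maps_def PiE_iff)+
    then have "commutator Maps f g = (\<lambda>s\<in>S. commutator G (f s) (g s))"
      by (auto simp: commutator_def Maps_def)
    then show ?thesis
      using f g commutator_F by (auto simp: PiE_iff)
  qed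
  ultimately show ?case by simp
next
  case (Suc K)
  have subgroup_K: "subgroup (Filtered K i) Maps" for i
    using Suc.IH by blast
  have comm_K: "commutator Maps f g \<in> Filtered K (i + j)"
    if "f \<in> Filtered K i" "g \<in> Filtered K j" for f g i j
    using Suc.IH that by blast
  note mult_K = subgroup.m_closed[OF subgroup_K]
  note inv_K = subgroup.m_inv_closed[OF subgroup_K]
  note car = subsetD[OF Filtered_subset]
  have drop_index: "f \<in> Filtered K i" if "f \<in> Filtered K j" "i \<le> j" for f i j
    using that Filtered_antimono by blast
  have drop_height: "f \<in> Filtered K i" if "f \<in> Filtered (Suc K) i" for f i
    using that Filtered_Suc_height by blast
  have conj_K: "f \<otimes>\<^bsub>Maps\<^esub> g \<otimes>\<^bsub>Maps\<^esub> inv\<^bsub>Maps\<^esub> f \<in> Filtered K j"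
    if f: "f \<in> Filtered K i" and g: "g \<in> Filtered K j" for f g i j
  proof -
    have "commutator Maps f g \<in> Filtered K j"
      using drop_index[OF comm_K[OF f g]] by simp
    then show ?thesis
      using mult_K g car[OF f] car[OF g] by (simp add: Maps.conjugate_eq_commutator_mult)
  qed
  \<comment> \<open>A right difference is a left difference times a commutator with it, so checking the left
      differences is enough.\<close>
  have Suc_heightI: "f \<in> Filtered (Suc K) i"
    if f: "f \<in> Filtered K i"
      and left: "\<And>s. s \<in> S \<Longrightarrow> shift s f \<otimes>\<^bsub>Maps\<^esub> inv\<^bsub>Maps\<^esub> f \<in> Filtered K (Suc i)"
    for f i
  proof -
    have "inv\<^bsub>Maps\<^esub> f \<otimes>\<^bsub>Maps\<^esub> shift s f \<in> Filtered K (Suc i)" if s: "s \<in> S" for s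
    proof -
      have "commutator Maps (inv\<^bsub>Maps\<^esub> f) (shift s f \<otimes>\<^bsub>Maps\<^esub> inv\<^bsub>Maps\<^esub> f) \<in> Filtered K (Suc i)"
        using drop_index[OF comm_K[OF inv_K[OF f] left[OF s]]] by simp
      then show ?thesis
        using mult_K left[OF s] car[OF f] shift_closed[OF car[OF f] s]
        by (simp add: Maps.right_quotient_eq)
    qed
    with left f show ?thesis
      using car[OF f] differences_in_PiE[of S add G F K i f]
      by (auto simp: Filtered_def left_diff_eq right_diff_eq)
  qed
  have mult: "f \<otimes>\<^bsub>Maps\<^esub> g \<in> Filtered (Suc K) i"
    if f: "f \<in> Filtered (Suc K) i" and g: "g \<in> Filtered (Suc K) i" for f g i
  proof (rule Suc_heightI)
    show "f \<otimes>\<^bsub>Maps\<^esub> g \<in> Filtered K i"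
      using f g drop_height mult_K by blast
  next
    fix s assume s: "s \<in> S"
    have "commutator Maps f (shift s g \<otimes>\<^bsub>Maps\<^esub> inv\<^bsub>Maps\<^esub> g) \<in> Filtered K (Suc i)"
      using drop_index[OF comm_K[OF drop_height[OF f] Filtered_SucD[OF g s]]] by simp
    then show "shift s (f \<otimes>\<^bsub>Maps\<^esub> g) \<otimes>\<^bsub>Maps\<^esub> inv\<^bsub>Maps\<^esub> (f \<otimes>\<^bsub>Maps\<^esub> g) \<in> Filtered K (Suc i)"
      using car[OF f] car[OF g] shift_closed s Filtered_SucD[OF f s] Filtered_SucD[OF g s] mult_K
      by (simp add: shift_mult Maps.left_quotient_mult)
  qed
  have inv: "inv\<^bsub>Maps\<^esub> f \<in> Filtered (Suc K) i" if f: "f \<in> Filtered (Suc K) i" for f i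
  proof (rule Suc_heightI)
    show "inv\<^bsub>Maps\<^esub> f \<in> Filtered K i"
      using f drop_height inv_K by blast
  next
    fix s assume s: "s \<in> S"
    let ?a = "shift s f \<otimes>\<^bsub>Maps\<^esub> inv\<^bsub>Maps\<^esub> f"
    have a: "inv\<^bsub>Maps\<^esub> ?a \<in> Filtered K (Suc i)"
      using Filtered_SucD[OF f s] inv_K by blast
    have "commutator Maps (inv\<^bsub>Maps\<^esub> f) (inv\<^bsub>Maps\<^esub> ?a) \<in> Filtered K (Suc i)"
      using drop_index[OF comm_K[OF inv_K[OF drop_height[OF f]] a]] by simp
    from mult_K[OF this a]
    show "shift s (inv\<^bsub>Maps\<^esub> f) \<otimes>\<^bsub>Maps\<^esub> inv\<^bsub>Maps\<^esub> (inv\<^bsub>Maps\<^esub> f) \<in> Filtered K (Suc i)"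
      using Maps.left_quotient_inv[OF car[OF f] shift_closed[OF car[OF f] s]] car[OF f] s
      by (simp add: shift_inv)
  qed
  have comm: "commutator Maps f g \<in> Filtered (Suc K) (i + j)"
    if f: "f \<in> Filtered (Suc K) i" and g: "g \<in> Filtered (Suc K) j" for f g i j
  proof (rule Suc_heightI)
    show c_K: "commutator Maps f g \<in> Filtered K (i + j)"
      using comm_K drop_height f g by blast
    fix s assume s: "s \<in> S"
    define a where "a = shift s f \<otimes>\<^bsub>Maps\<^esub> inv\<^bsub>Maps\<^esub> f"
    define b where "b = shift s g \<otimes>\<^bsub>Maps\<^esub> inv\<^bsub>Maps\<^esub> g"
    define c where "c = commutator Maps f g"
    have a: "a \<in> Filtered K (Suc i)" and b: "b \<in> Filtered K (Suc j)"
      unfolding a_def b_def using Filtered_SucD f g s by blast+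
    have c: "c \<in> Filtered K (i + j)" using c_K unfolding c_def .
    let ?Q = "Filtered K (Suc (i + j))"
    have "commutator Maps f b \<in> ?Q"
      using comm_K[OF drop_height[OF f] b] by simp
    then have 1: "a \<otimes>\<^bsub>Maps\<^esub> commutator Maps f b \<otimes>\<^bsub>Maps\<^esub> inv\<^bsub>Maps\<^esub> a \<in> ?Q"
      by (rule conj_K[OF a])
    \<comment> \<open>\<open>c\<close> is already deep, so for the commutator with \<open>a b\<close> one extra level suffices.\<close>
    have "a \<otimes>\<^bsub>Maps\<^esub> b \<in> Filtered K (Suc 0)"
      using a b drop_index by (intro mult_K) auto
    from comm_K[OF this c] have 2: "commutator Maps (a \<otimes>\<^bsub>Maps\<^esub> b) c \<in> ?Q"
      by simp
    have "commutator Maps a b \<in> ?Q"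
      using drop_index[OF comm_K[OF a b]] by simp
    moreover have "commutator Maps a g \<in> ?Q"
      using comm_K[OF a drop_height[OF g]] by simp
    ultimately have "commutator Maps a b \<otimes>\<^bsub>Maps\<^esub>
        (b \<otimes>\<^bsub>Maps\<^esub> commutator Maps a g \<otimes>\<^bsub>Maps\<^esub> inv\<^bsub>Maps\<^esub> b) \<in> ?Q"
      by (intro mult_K conj_K[OF b])
    note 3 = conj_K[OF c this]
    have "commutator Maps (shift s f) (shift s g) \<otimes>\<^bsub>Maps\<^esub> inv\<^bsub>Maps\<^esub> c \<in> ?Q"
      using Maps.left_quotient_commutator[OF car[OF f] car[OF g] shift_closed[OF car[OF f] s]
          shift_closed[OF car[OF g] s] a_def b_def c_def] mult_K[OF mult_K[OF 1 2] 3]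
      by simp
    then show "shift s (commutator Maps f g) \<otimes>\<^bsub>Maps\<^esub> inv\<^bsub>Maps\<^esub> (commutator Maps f g) \<in> ?Q"
      using car[OF f] car[OF g] s by (simp add: shift_commutator c_def)
  qed
  have one: "\<one>\<^bsub>Maps\<^esub> \<in> Filtered (Suc K) i" for i
    using subgroup.one_closed[OF subgroup_K]
  proof (intro Suc_heightI)
    fix s assume s: "s \<in> S"
    have "shift s \<one>\<^bsub>Maps\<^esub> = \<one>\<^bsub>Maps\<^esub>"
      using s by (auto simp: Maps_def shift_def closed)
    then show "shift s \<one>\<^bsub>Maps\<^esub> \<otimes>\<^bsub>Maps\<^esub> inv\<^bsub>Maps\<^esub> \<one>\<^bsub>Maps\<^esub> \<in> Filtered K (Suc i)"
      using subgroup.one_closed[OF subgroup_K] by simp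
  qed simp
  have "subgroup (Filtered (Suc K) i) Maps" for i
    by (rule Maps.subgroupI) (use one mult inv Filtered_subset in blast)+
  with comm show ?case by blast
qed

corollary subgroup_all_differences_in:
  "subgroup {f. \<forall>K. differences_in S add G F K 0 f} (product_group S (\<lambda>_. G))"
proof -
  have "{f. \<forall>K. differences_in S add G F K 0 f} = (\<Inter>K. Filtered K 0)"
    by (auto simp: Filtered_def)
  moreover have "subgroup (\<Inter>K. Filtered K 0) Maps"
    using Filtered_subgroup_commutator by (intro Maps.subgroups_Inter) auto
  ultimately show ?thesis
    by (simp add: Maps_def)
qed

end


section \<open>Degrees of polynomial maps as filtrations\<close>

text \<open>
  The filtration-like sequence that encodes degree at most \<open>e\<close> modulo \<open>N\<close>: differences of order
  up to \<open>e\<close> are arbitrary, those of higher order vanish modulo \<open>N\<close>.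
\<close>

definition degree_filtration ::
    "('g, 'm) monoid_scheme \<Rightarrow> 'g set \<Rightarrow> degree_value \<Rightarrow> nat \<Rightarrow> 'g set" where
  "degree_filtration G N e k = (if Fin k \<le> e then carrier G else N)"

lemma degree_filtration_MInf [simp]: "degree_filtration G N MInf = (\<lambda>_. N)"
  by (simp add: degree_filtration_def fun_eq_iff)

lemma degree_filtration_Suc [simp]:
  "(\<lambda>k. degree_filtration G N (Fin (Suc d)) (Suc k)) = degree_filtration G N (Fin d)"
  "(\<lambda>k. degree_filtration G N (Fin 0) (Suc k)) = (\<lambda>_. N)"
  by (simp_all add: degree_filtration_def fun_eq_iff)

lemma degree_filtration_0 [simp]: "degree_filtration G N (Fin d) 0 = carrier G"
  by (simp add: degree_filtration_def)

lemma poly_degree_le_PiE: "poly_degree_le S add G e f \<Longrightarrow> f \<in> S \<rightarrow>\<^sub>E carrier G"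
  by (cases "(S, add, G, e, f)" rule: poly_degree_le.cases) simp_all

context comm_semigroup_on
begin

lemma differences_in_subgroup:
  assumes "group G" "subgroup N G" "f \<in> S \<rightarrow>\<^sub>E N"
  shows "differences_in S add G (\<lambda>_. N) K i f"
  using assms(3)
proof (induction K arbitrary: i f)
  case 0
  then show ?case by simp
next
  case (Suc K)
  interpret N: subgroup N G by fact
  have "left_diff S add G s f \<in> S \<rightarrow>\<^sub>E N" "right_diff S add G s f \<in> S \<rightarrow>\<^sub>E N" if "s \<in> S" for s
    using Suc.prems that closed by (auto simp: left_diff_def right_diff_def PiE_iff)
  with Suc show ?case by simp
qed

text \<open>
  Stated for a homomorphism, this covers \<open>G\<close> itself (the identity map) as well as its quotients.
  Commutativity of the semigroup enters in degree \<open>0\<close>: trivial differences mean that \<open>h \<circ> f\<close>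
  does not change from \<open>t\<close> to \<open>s + t\<close>, and then \<open>s\<close> and \<open>t\<close> have the same value because
  both lead to \<open>s + t = t + s\<close>.
\<close>

lemma poly_degree_le_hom_iff:
  assumes "group_hom G Q h" and f: "f \<in> S \<rightarrow>\<^sub>E carrier G"
  shows "poly_degree_le S add Q e (\<lambda>s\<in>S. h (f s)) \<longleftrightarrow>
         (\<forall>K. differences_in S add G (degree_filtration G (kernel G Q h) e) K 0 f)"
proof -
  interpret group_hom G Q h by fact
  let ?N = "kernel G Q h"
  note N_differences = differences_in_subgroup[OF G.is_group subgroup_kernel]
  have in_Q: "(\<lambda>s\<in>S. h (g s)) \<in> S \<rightarrow>\<^sub>E carrier Q" if "g \<in> S \<rightarrow>\<^sub>E carrier G" for g
    using that by (auto simp: PiE_iff)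
  have left: "left_diff S add G s g \<in> S \<rightarrow>\<^sub>E carrier G"
       "left_diff S add Q s (\<lambda>s\<in>S. h (g s)) = (\<lambda>t\<in>S. h (left_diff S add G s g t))"
   and right: "right_diff S add G s g \<in> S \<rightarrow>\<^sub>E carrier G"
       "right_diff S add Q s (\<lambda>s\<in>S. h (g s)) = (\<lambda>t\<in>S. h (right_diff S add G s g t))"
    if "g \<in> S \<rightarrow>\<^sub>E carrier G" "s \<in> S" for g s
    using that closed by (auto simp: left_diff_def right_diff_def PiE_iff intro!: restrict_ext)
  have Fin_iff: "poly_degree_le S add Q (Fin d) (\<lambda>s\<in>S. h (g s)) \<longleftrightarrow>
        (\<forall>K. differences_in S add G (degree_filtration G ?N (Fin d)) K 0 g)"
    if "g \<in> S \<rightarrow>\<^sub>E carrier G" for g d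
    using that
  proof (induction d arbitrary: g)
    case 0
    show ?case
    proof
      assume "poly_degree_le S add Q (Fin 0) (\<lambda>s\<in>S. h (g s))"
      then obtain c where "c \<in> carrier Q" "\<And>s. s \<in> S \<Longrightarrow> h (g s) = c"
        by auto
      then have "left_diff S add G s g \<in> S \<rightarrow>\<^sub>E ?N" "right_diff S add G s g \<in> S \<rightarrow>\<^sub>E ?N"
        if "s \<in> S" for s
        using 0 that closed
        by (auto simp: left_diff_def right_diff_def PiE_iff kernel_def)
      then show "\<forall>K. differences_in S add G (degree_filtration G ?N (Fin 0)) K 0 g"
        unfolding all_differences_in_iff[of S add G _ 0] unfolding differences_in_Suc_index
        using 0 N_differences by simp
    next
      assume *: "\<forall>K. differences_in S add G (degree_filtration G ?N (Fin 0)) K 0 g"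
      have "\<forall>K. differences_in S add G (\<lambda>_. ?N) K 0 (left_diff S add G s g)" if "s \<in> S" for s
        using *[unfolded all_differences_in_iff[of S add G _ 0], unfolded differences_in_Suc_index]
          that
        by simp
      then have "left_diff S add G s g \<in> S \<rightarrow>\<^sub>E ?N" if "s \<in> S" for s
        using that differences_in_PiE by blast
      then have in_N: "left_diff S add G s g t \<in> ?N" if "s \<in> S" "t \<in> S" for s t
        using that by (auto simp: PiE_iff)
      have shift: "h (g (add s t)) = h (g t)" if "s \<in> S" "t \<in> S" for s t
      proof -
        have car: "g (add s t) \<in> carrier G" "g t \<in> carrier G"
          using 0 that closed by auto
        have "h (g (add s t)) \<otimes>\<^bsub>Q\<^esub> inv\<^bsub>Q\<^esub> h (g t) = \<one>\<^bsub>Q\<^esub>"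
          using in_N[OF that] that car
          by (simp add: left_diff_def kernel_def)
        then show ?thesis
          using car by (metis H.inv_equality H.inv_inv H.inv_closed hom_closed)
      qed
      obtain s0 where s0: "s0 \<in> S" using nonempty by blast
      have "h (g s) = h (g s0)" if "s \<in> S" for s
        using shift[OF that s0] shift[OF s0 that] commute[OF that s0] by simp
      then show "poly_degree_le S add Q (Fin 0) (\<lambda>s\<in>S. h (g s))"
        using in_Q[OF 0] PiE_mem[OF 0 s0] by (simp add: bexI[of _ "h (g s0)"])
    qed
  next
    case (Suc d)
    have step: "poly_degree_le S add Q (Fin d) (left_diff S add Q s (\<lambda>s\<in>S. h (g s))) \<longleftrightarrow>
          (\<forall>K. differences_in S add G (degree_filtration G ?N (Fin d)) K 0 (left_diff S add G s g))"
         "poly_degree_le S add Q (Fin d) (right_diff S add Q s (\<lambda>s\<in>S. h (g s))) \<longleftrightarrow>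
          (\<forall>K. differences_in S add G (degree_filtration G ?N (Fin d)) K 0 (right_diff S add G s g))"
      if "s \<in> S" for s
      by (simp_all only: left(2)[OF Suc.prems that] Suc.IH[OF left(1)[OF Suc.prems that]]
          right(2)[OF Suc.prems that] Suc.IH[OF right(1)[OF Suc.prems that]])
    show ?case
      unfolding all_differences_in_iff[of S add G _ 0] poly_degree_le.simps(3)
      unfolding differences_in_Suc_index degree_filtration_Suc degree_filtration_0
      by (simp only: in_Q[OF Suc.prems] Suc.prems step cong: ball_cong)
  qed
  show ?thesis
  proof (cases e)
    case (Fin d)
    then show ?thesis using Fin_iff[OF f] by simp
  next
    case MInf
    have "(\<forall>K. differences_in S add G (\<lambda>_. ?N) K 0 f) \<longleftrightarrow> f \<in> S \<rightarrow>\<^sub>E ?N"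
      using N_differences differences_in_PiE[of S add G "\<lambda>_. ?N"] by blast
    also have "\<dots> \<longleftrightarrow> poly_degree_le S add Q MInf (\<lambda>s\<in>S. h (f s))"
      using f in_Q[OF f] by (auto simp: kernel_def PiE_iff)
    finally show ?thesis using MInf by simp
  qed
qed

lemma poly_degree_le_iff:
  assumes "group G"
  shows "poly_degree_le S add G e f \<longleftrightarrow>
         f \<in> S \<rightarrow>\<^sub>E carrier G \<and>
         (\<forall>K. differences_in S add G (degree_filtration G {\<one>\<^bsub>G\<^esub>} e) K 0 f)"
proof (cases "f \<in> S \<rightarrow>\<^sub>E carrier G")
  case True
  have id_hom: "group_hom G G (\<lambda>x. x)"
    using assms by (auto simp: group_hom_def group_hom_axioms_def hom_def)
  have "kernel G G (\<lambda>x. x) = {\<one>\<^bsub>G\<^esub>}" "(\<lambda>s\<in>S. f s) = f"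
    using True group.subgroup_self[OF assms, THEN subgroup.one_closed]
    by (auto simp: kernel_def PiE_iff extensional_restrict)
  then show ?thesis
    using poly_degree_le_hom_iff[OF id_hom True] True by simp
next
  case False
  then show ?thesis using poly_degree_le_PiE by blast
qed

lemma poly_degree_le_mod_iff:
  assumes "N \<lhd> G" "f \<in> S \<rightarrow>\<^sub>E carrier G"
  shows "poly_degree_le S add (G Mod N) e (map_mod S G N f) \<longleftrightarrow>
         (\<forall>K. differences_in S add G (degree_filtration G N e) K 0 f)"
proof -
  interpret normal N G by fact
  have "group_hom G (G Mod N) (\<lambda>a. N #>\<^bsub>G\<^esub> a)"
    using r_coset_hom_Mod factorgroup_is_group
    by (simp add: group_hom_def group_hom_axioms_def)
  moreover have "kernel G (G Mod N) (\<lambda>a. N #>\<^bsub>G\<^esub> a) = N"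
  proof -
    have "N #>\<^bsub>G\<^esub> a = N \<longleftrightarrow> a \<in> N" if "a \<in> carrier G" for a
      using coset_join1[OF _ that subgroup_axioms] coset_join2[OF that subgroup_axioms] by blast
    then show ?thesis
      using mem_carrier unfolding kernel_def one_FactGroup by blast
  qed
  ultimately show ?thesis
    using poly_degree_le_hom_iff[of G "G Mod N" "\<lambda>a. N #>\<^bsub>G\<^esub> a" f e] assms(2)
    by (simp add: map_mod_def)
qed

lemma all_differences_in_degree_filtration_mono:
  assumes "e \<le> e'" "N \<subseteq> N'" "N \<subseteq> carrier G"
    and "differences_in S add G (degree_filtration G N e) K 0 f"
  shows "differences_in S add G (degree_filtration G N' e') K 0 f"
proof (rule differences_in_mono[OF _ assms(4)])
  show "degree_filtration G N e k \<subseteq> degree_filtration G N' e' k" for k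
    using assms(1-3) by (auto simp: degree_filtration_def intro: order_trans)
qed

lemma polynomial_map_finite_degree:
  assumes "group G" "polynomial_map S add G f"
  obtains D where "poly_degree_le S add G (Fin D) f"
proof -
  obtain e where e: "poly_degree_le S add G e f"
    using assms(2) by (auto simp: polynomial_map_def)
  show ?thesis
  proof (cases e)
    case MInf
    with e have "poly_degree_le S add G (Fin 0) f"
      using group.is_monoid[OF assms(1)] by (auto intro: monoid.one_closed)
    then show ?thesis by (rule that)
  next
    case (Fin D)
    with e that show ?thesis by simp
  qed
qed

text \<open>
  The degree is a least element, hence meaningful only if some bound holds; for a polynomial map
  a bound in \<open>G\<close> gives one in each quotient.
\<close>

lemma lc_degree_le_iff:
  assumes "group G" "polynomial_map S add G f"
  shows "lc_degree S add G f i \<le> e \<longleftrightarrow>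
         (\<forall>K. differences_in S add G (degree_filtration G (lower_central G (Suc i)) e) K 0 f)"
proof -
  let ?N = "lower_central G (Suc i)"
  have N: "?N \<lhd> G" "\<one>\<^bsub>G\<^esub> \<in> ?N" "?N \<subseteq> carrier G"
    using group.lower_central_normal[OF assms(1)] group.lower_central_subgroup[OF assms(1)]
    by (auto simp: subgroup.one_closed dest: subgroup.subset)
  let ?le = "\<lambda>e. poly_degree_le S add (G Mod ?N) e (map_mod S G ?N f)"
  obtain D where D: "poly_degree_le S add G (Fin D) f"
    using polynomial_map_finite_degree[OF assms] .
  then have f: "f \<in> S \<rightarrow>\<^sub>E carrier G" by (rule poly_degree_le_PiE)
  note le_iff = poly_degree_le_mod_iff[OF N(1) f]
  have "?le (Fin D)"
    using D N
      all_differences_in_degree_filtration_mono[of "Fin D" "Fin D" "{\<one>\<^bsub>G\<^esub>}" ?N G]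
    unfolding le_iff poly_degree_le_iff[OF assms(1)] by blast
  then have "?le (LEAST e. ?le e)"
    by (rule LeastI)
  moreover have "?le b" if "?le a" "a \<le> b" for a b
    using that all_differences_in_degree_filtration_mono[OF that(2) subset_refl N(3)]
    unfolding le_iff by blast
  ultimately have "(LEAST e. ?le e) \<le> e \<longleftrightarrow> ?le e"
    using Least_le[of ?le e] by metis
  then show ?thesis
    by (simp add: lc_degree_def poly_degree_def le_iff)
qed

end


section \<open>The filtration of a superadditive vector\<close>

text \<open>
  The index \<open>i = 0\<close> contributes only the condition to lie in the carrier, since
  \<^term>\<open>lower_central G 1\<close> is the carrier; including it keeps the intersection nonempty for
  \<open>n = 0\<close>.
\<close>

definition lc_filtration ::
    "('g, 'm) monoid_scheme \<Rightarrow> nat \<Rightarrow> (nat \<Rightarrow> degree_value) \<Rightarrow> nat \<Rightarrow> 'g set" where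
  "lc_filtration G n d k =
     (\<Inter>i\<in>{0..n}. degree_filtration G (lower_central G (Suc i)) (d i) k)"

lemma (in group) mem_lc_filtration_iff:
  "x \<in> lc_filtration G n d k \<longleftrightarrow>
   x \<in> carrier G \<and> (\<forall>i\<le>n. Fin k \<le> d i \<or> x \<in> lower_central G (Suc i))"
proof -
  have "lc_filtration G n d k \<subseteq> degree_filtration G (lower_central G (Suc 0)) (d 0) k"
    unfolding lc_filtration_def by (rule INT_lower) simp
  also have "\<dots> = carrier G"
    by (simp add: degree_filtration_def lower_central_1)
  finally have "lc_filtration G n d k \<subseteq> carrier G" .
  then show ?thesis
    using lower_central_subset by (auto simp: lc_filtration_def degree_filtration_def)
qed

text \<open>
  Let \<open>d\<^sub>i < k + l\<close>, and let \<open>p, q \<le> i\<close> be largest with \<open>x \<in> C\<^bsup>p+1\<^esup>\<close> and \<open>y \<in> C\<^bsup>q+1\<^esup>\<close>. Then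
  \<open>[x, y] \<in> C\<^bsup>p+q+2\<^esup>\<close>, which is contained in \<open>C\<^bsup>i+1\<^esup>\<close> unless \<open>p + q + 2 \<le> i\<close>. But in that case
  maximality forces \<open>k \<le> d\<^bsub>p+1\<^esub>\<close> and \<open>l \<le> d\<^bsub>q+1\<^esub>\<close>, and superadditivity gives
  \<open>k + l \<le> d\<^bsub>p+q+2\<^esub> \<le> d\<^sub>i\<close>, a contradiction.
\<close>

lemma (in group) lc_filtration_commutator:
  assumes d: "superadditive n d"
    and x: "x \<in> lc_filtration G n d k" and y: "y \<in> lc_filtration G n d l"
  shows "commutator G x y \<in> lc_filtration G n d (k + l)"
proof -
  have "commutator G x y \<in> lower_central G (Suc i)"
    if i: "i \<le> n" and small: "\<not> Fin (k + l) \<le> d i" for i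
  proof -
    have deepest: "\<exists>p\<le>i. z \<in> lower_central G (Suc p) \<and> (p < i \<longrightarrow> Fin m \<le> d (Suc p))"
      if "z \<in> lc_filtration G n d m" for z m
    proof -
      let ?P = "\<lambda>p. p \<le> i \<and> z \<in> lower_central G (Suc p)"
      have "?P 0"
        using that by (simp add: mem_lc_filtration_iff lower_central_1)
      then have P: "?P (GREATEST p. ?P p)"
        by (rule GreatestI_nat[where b = i]) simp
      have "\<not> ?P (Suc (GREATEST p. ?P p))"
        using Greatest_le_nat[of ?P _ i] not_less_eq_eq by blast
      then have "Fin m \<le> d (Suc (GREATEST p. ?P p))" if "(GREATEST p. ?P p) < i"
        using that i \<open>z \<in> lc_filtration G n d m\<close> Suc_leI[OF that] le_trans
        unfolding mem_lc_filtration_iff by blast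
      with P show ?thesis by blast
    qed
    obtain p where p: "x \<in> lower_central G (Suc p)" "p \<le> i" "p < i \<Longrightarrow> Fin k \<le> d (Suc p)"
      using deepest[OF x] by blast
    obtain q where q: "y \<in> lower_central G (Suc q)" "q \<le> i" "q < i \<Longrightarrow> Fin l \<le> d (Suc q)"
      using deepest[OF y] by blast
    have "i \<le> Suc (p + q)"
    proof (rule ccontr)
      assume "\<not> i \<le> Suc (p + q)"
      then have pq: "Suc p + Suc q \<le> i" by simp
      have "d (Suc p) + d (Suc q) \<le> d (Suc p + Suc q)"
        using d[unfolded superadditive_def, THEN conjunct2, rule_format, of "Suc p" "Suc q"] pq i
        by simp
      also have "\<dots> \<le> d i"
        using d[unfolded superadditive_def, THEN conjunct1, rule_format, of "Suc p + Suc q" i] pq i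
        by simp
      finally have "d (Suc p) + d (Suc q) \<le> d i" .
      moreover have "Fin k \<le> d (Suc p)" "Fin l \<le> d (Suc q)"
        using p(3) q(3) pq by simp_all
      then have "Fin (k + l) \<le> d (Suc p) + d (Suc q)"
        by (cases "d (Suc p)"; cases "d (Suc q)") simp_all
      ultimately show False
        using small order_trans by blast
    qed
    then show ?thesis
      using commutator_lower_central[OF p(1) q(1)] lower_central_antimono by blast
  qed
  then show ?thesis
    using x y by (auto simp: mem_lc_filtration_iff commutator_closed)
qed

lemma (in group) filtration_lc_filtration:
  assumes "superadditive n d"
  shows "filtration G (lc_filtration G n d)"
proof (intro filtration.intro filtration_axioms.intro is_group)
  fix k
  have "subgroup (degree_filtration G (lower_central G (Suc i)) e k) G" for i e
    by (simp add: degree_filtration_def lower_central_subgroup subgroup_self)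
  then show "subgroup (lc_filtration G n d k) G"
    unfolding lc_filtration_def by (intro subgroups_Inter) auto
next
  fix k
  have "Fin k \<le> e" if "Fin (Suc k) \<le> e" for e
    using that by (cases e) simp_all
  then show "lc_filtration G n d (Suc k) \<subseteq> lc_filtration G n d k"
    unfolding subset_iff mem_lc_filtration_iff by blast
next
  fix x y k l
  assume "x \<in> lc_filtration G n d k" "y \<in> lc_filtration G n d l"
  then show "commutator G x y \<in> lc_filtration G n d (k + l)"
    by (rule lc_filtration_commutator[OF assms])
qed

context comm_semigroup_on
begin

text \<open>
  From right to left, the component \<open>i = n\<close> bounds the degree of \<open>f\<close> itself, because
  \<open>C\<^bsup>n+1\<^esup>\<close> is trivial; so \<open>f\<close> is a polynomial map.
\<close>

lemma bounded_lc_degree_iff: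
  assumes "group G" and lc: "lower_central G (Suc n) = {\<one>\<^bsub>G\<^esub>}"
  shows "polynomial_map S add G f \<and> vector_le n (lc_degree S add G f) d \<longleftrightarrow>
         (\<forall>K. differences_in S add G (lc_filtration G n d) K 0 f)"
    (is "?L \<longleftrightarrow> ?R")
proof -
  interpret group G by fact
  let ?D = "\<lambda>i. \<forall>K. differences_in S add G (degree_filtration G (lower_central G (Suc i)) (d i)) K 0 f"
  have R_iff: "?R \<longleftrightarrow> (\<forall>i\<le>n. ?D i)"
    unfolding lc_filtration_def by (subst differences_in_INT) auto
  have D_0: "?D 0" if "f \<in> S \<rightarrow>\<^sub>E carrier G"
  proof -
    have "degree_filtration G (lower_central G (Suc 0)) (d 0) = (\<lambda>_. carrier G)"
      by (simp add: degree_filtration_def lower_central_1 fun_eq_iff)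
    then show ?thesis
      using differences_in_subgroup[OF is_group subgroup_self that] by simp
  qed
  have vector_le_iff: "vector_le n (lc_degree S add G f) d \<longleftrightarrow> (\<forall>i\<in>{1..n}. ?D i)"
    if "polynomial_map S add G f"
    using lc_degree_le_iff[OF is_group that] by (simp add: vector_le_def)
  show ?thesis
  proof
    assume L: ?L
    then have "f \<in> S \<rightarrow>\<^sub>E carrier G"
      unfolding polynomial_map_def using poly_degree_le_PiE by blast
    with L have "?D i" if "i \<le> n" for i
      using D_0 vector_le_iff that by (cases "i = 0") auto
    then show ?R using R_iff by blast
  next
    assume R: ?R
    then have D: "\<forall>i\<le>n. ?D i" using R_iff by blast
    have "f \<in> S \<rightarrow>\<^sub>E lc_filtration G n d 0"
      using R differences_in_PiE by blast
    then have "f \<in> S \<rightarrow>\<^sub>E carrier G"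
      by (auto simp: PiE_iff mem_lc_filtration_iff)
    moreover have "?D n" using D by blast
    ultimately have "poly_degree_le S add G (d n) f"
      unfolding poly_degree_le_iff[OF is_group] lc by blast
    then have "polynomial_map S add G f"
      by (auto simp: polynomial_map_def)
    then show ?L using vector_le_iff D by auto
  qed
qed

lemma subgroup_bounded_lc_degree:
  assumes "group G" "lower_central G (Suc n) = {\<one>\<^bsub>G\<^esub>}" "superadditive n d"
  shows "subgroup {f. polynomial_map S add G f \<and> vector_le n (lc_degree S add G f) d}
           (product_group S (\<lambda>_. G))"
proof -
  have "filtered_maps G (lc_filtration G n d) S add"
    by (rule filtered_maps.intro[OF group.filtration_lc_filtration[OF assms(1,3)]
          comm_semigroup_on_axioms])
  then have "subgroup {f. \<forall>K. differences_in S add G (lc_filtration G n d) K 0 f}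
      (product_group S (\<lambda>_. G))"
    by (rule filtered_maps.subgroup_all_differences_in)
  then show ?thesis
    unfolding bounded_lc_degree_iff[OF assms(1,2)] .
qed

text \<open>
  The constant vector \<open>(D, \<dots>, D)\<close> is in general not superadditive, which is why maps of degree at most
  \<open>D\<close> are placed in the group of the larger vector \<open>(D, 2D, \<dots>, nD)\<close>. Any two polynomial maps
  lie in one of these groups.
\<close>

lemma subgroup_polynomial_maps:
  assumes "group G" and lc: "lower_central G (Suc n) = {\<one>\<^bsub>G\<^esub>}"
  shows "subgroup {f. polynomial_map S add G f} (product_group S (\<lambda>_. G))"
proof -
  interpret group G by fact
  interpret Maps: group "product_group S (\<lambda>_. G)" by simp
  define v where "v D = (\<lambda>i. Fin (i * D))" for D
  define B where "B D = {f. polynomial_map S add G f \<and> vector_le n (lc_degree S add G f) (v D)}"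
    for D
  have "superadditive n (v D)" for D
    by (simp add: superadditive_def v_def distrib_right)
  then have B_subgroup: "subgroup (B D) (product_group S (\<lambda>_. G))" for D
    unfolding B_def by (rule subgroup_bounded_lc_degree[OF assms])
  have B_mono: "f \<in> B E" if "f \<in> B D" "D \<le> E" for f D E
  proof -
    have "v D i \<le> v E i" for i
      using \<open>D \<le> E\<close> by (simp add: v_def)
    then show ?thesis
      using \<open>f \<in> B D\<close> unfolding B_def vector_le_def by (blast intro: order_trans)
  qed
  have in_B: "\<exists>D. f \<in> B D" if f: "polynomial_map S add G f" for f
  proof -
    obtain D where D: "poly_degree_le S add G (Fin D) f"
      using polynomial_map_finite_degree[OF is_group f] .
    have "lc_degree S add G f i \<le> v D i" if "i \<in> {1..n}" for i
      unfolding lc_degree_le_iff[OF is_group f]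
    proof
      fix K
      have "Fin D \<le> v D i" using that by (simp add: v_def)
      moreover have "{\<one>\<^bsub>G\<^esub>} \<subseteq> lower_central G (Suc i)"
        using lower_central_subgroup subgroup.one_closed by blast
      ultimately show
        "differences_in S add G (degree_filtration G (lower_central G (Suc i)) (v D i)) K 0 f"
        using D all_differences_in_degree_filtration_mono[of "Fin D" _ "{\<one>\<^bsub>G\<^esub>}" _ G]
        unfolding poly_degree_le_iff[OF is_group] by blast
    qed
    then show ?thesis
      using f by (intro exI[of _ D]) (simp add: B_def vector_le_def)
  qed
  have B_poly: "polynomial_map S add G f" if "f \<in> B D" for f D
    using that by (simp add: B_def)
  show ?thesis
  proof (rule Maps.subgroupI)
    show "{f. polynomial_map S add G f} \<subseteq> carrier (product_group S (\<lambda>_. G))"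
      using in_B B_subgroup subgroup.subset by blast
    show "{f. polynomial_map S add G f} \<noteq> {}"
      using subgroup.one_closed[OF B_subgroup] B_poly by blast
  next
    fix f assume "f \<in> {f. polynomial_map S add G f}"
    then show "inv\<^bsub>product_group S (\<lambda>_. G)\<^esub> f \<in> {f. polynomial_map S add G f}"
      using in_B B_poly subgroup.m_inv_closed[OF B_subgroup] by blast
  next
    fix f g assume "f \<in> {f. polynomial_map S add G f}" "g \<in> {f. polynomial_map S add G f}"
    then obtain D E where "f \<in> B D" "g \<in> B E"
      using in_B by blast
    then have "f \<in> B (max D E)" "g \<in> B (max D E)"
      using B_mono by auto
    then show "f \<otimes>\<^bsub>product_group S (\<lambda>_. G)\<^esub> g \<in> {f. polynomial_map S add G f}"
      using B_poly subgroup.m_closed[OF B_subgroup] by blast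
  qed
qed

end


section \<open>Nilpotency\<close>

lemma (in group_hom) hom_commutator:
  assumes "x \<in> carrier G" "y \<in> carrier G"
  shows "h (commutator G x y) = commutator H (h x) (h y)"
  using assms by (simp add: commutator_def)

lemma (in group_hom) hom_lower_central:
  "h ` lower_central G (Suc i) \<subseteq> lower_central H (Suc i)"
proof (induction i)
  case 0
  show ?case
    by (auto simp: G.lower_central_1 H.lower_central_1)
next
  case (Suc i)
  let ?A = "\<Union>x\<in>lower_central G (Suc i). \<Union>y\<in>carrier G. {commutator G x y}"
  have A: "?A \<subseteq> carrier G"
    using G.lower_central_subset G.commutator_closed by blast
  have "h ` ?A \<subseteq> (\<Union>x\<in>lower_central H (Suc i). \<Union>y\<in>carrier H. {commutator H x y})"
  proof
    fix z assume "z \<in> h ` ?A"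
    then obtain x y where xy: "x \<in> lower_central G (Suc i)" "y \<in> carrier G"
      "z = h (commutator G x y)"
      by blast
    then have "z = commutator H (h x) (h y)"
      using hom_commutator G.lower_central_subset by blast
    moreover have "h x \<in> lower_central H (Suc i)" "h y \<in> carrier H"
      using xy Suc.IH by auto
    ultimately show "z \<in> (\<Union>x\<in>lower_central H (Suc i). \<Union>y\<in>carrier H. {commutator H x y})"
      by blast
  qed
  then show ?case
    unfolding G.lower_central_Suc H.lower_central_Suc generate_img[OF A, symmetric]
    by (rule H.mono_generate)
qed

text \<open>
  Apply the previous lemma to the evaluations at the points of \<open>S\<close>: an element of the
  \<open>(n+1)\<close>-st term of the series has all its values in \<open>C\<^bsup>n+1\<^esup> = 1\<close>.
\<close>

lemma nilpotent_subgroup_product_group: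
  assumes "group G" and lc: "lower_central G (Suc n) = {\<one>\<^bsub>G\<^esub>}"
    and H: "subgroup H (product_group S (\<lambda>_. G))"
  shows "nilpotent_group ((product_group S (\<lambda>_. G))\<lparr>carrier := H\<rparr>)"
proof -
  let ?P = "(product_group S (\<lambda>_. G))\<lparr>carrier := H\<rparr>"
  have "group (product_group S (\<lambda>_. G))"
    using assms(1) by simp
  then interpret P: group ?P
    by (rule group.subgroup_imp_group[OF _ H])
  have f_1: "f = \<one>\<^bsub>?P\<^esub>" if f: "f \<in> lower_central ?P (Suc n)" for f
  proof -
    have f_H: "f \<in> S \<rightarrow>\<^sub>E carrier G"
      using f P.lower_central_subset subgroup.subset[OF H] by fastforce
    have "f s = \<one>\<^bsub>G\<^esub>" if s: "s \<in> S" for s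
    proof -
      have "(\<lambda>f. f s) \<in> hom ?P G"
        using s subgroup.subset[OF H] by (auto simp: hom_def PiE_iff)
      then interpret group_hom ?P G "\<lambda>f. f s"
        using P.is_group assms(1) by (simp add: group_hom_def group_hom_axioms_def)
      show ?thesis
        using hom_lower_central[of n] f lc by auto
    qed
    then show ?thesis
      using f_H by (auto simp: PiE_iff intro: extensionalityI)
  qed
  have "\<one>\<^bsub>?P\<^esub> \<in> lower_central ?P (Suc n)"
    using P.lower_central_subgroup subgroup.one_closed by blast
  with f_1 have "lower_central ?P (Suc n) = {\<one>\<^bsub>?P\<^esub>}"
    by blast
  then show ?thesis
    unfolding nilpotent_group_def Suc_eq_plus1 using P.is_group by blast
qed


section \<open>Polynomial maps of bounded lc-degree\<close>

theorem corollary7: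
  fixes S :: "'s set" and add :: "'s \<Rightarrow> 's \<Rightarrow> 's"
    and G :: "('g, 'm) monoid_scheme"
    and n :: nat and d :: "nat \<Rightarrow> degree_value"
  assumes "comm_semigroup_on S add"
    and "nilpotent_group G" and "nilpotency_class G = n"
    and "superadditive n d"
  defines "P \<equiv> polynomial_map_group S add G"
    and "H \<equiv> {f. polynomial_map S add G f \<and> vector_le n (lc_degree S add G f) d}"
  shows "group P \<and> subgroup H P \<and> nilpotent_group (P\<lparr>carrier := H\<rparr>)"
proof -
  interpret comm_semigroup_on S add by fact
  let ?M = "product_group S (\<lambda>_. G)" and ?B = "{f. polynomial_map S add G f}"
  have G: "group G"
    using assms(2) by (simp add: nilpotent_group_def)
  have "\<exists>n. lower_central G (n + 1) = {\<one>\<^bsub>G\<^esub>}"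
    using assms(2) by (simp add: nilpotent_group_def)
  from LeastI_ex[OF this] have lc: "lower_central G (Suc n) = {\<one>\<^bsub>G\<^esub>}"
    using assms(3) by (simp add: nilpotency_class_def)
  interpret M: group ?M using G by simp
  have B: "subgroup ?B ?M"
    by (rule subgroup_polynomial_maps[OF G lc])
  have H: "subgroup H ?M"
    unfolding H_def by (rule subgroup_bounded_lc_degree[OF G lc assms(4)])
  have P: "P = ?M\<lparr>carrier := ?B\<rparr>"
    by (simp add: P_def polynomial_map_group_def)
  have "group P"
    unfolding P by (rule M.subgroup_imp_group[OF B])
  moreover have "subgroup H P"
    unfolding P by (rule M.subgroup_incl[OF H B]) (auto simp: H_def)
  moreover have "nilpotent_group (P\<lparr>carrier := H\<rparr>)"
    using nilpotent_subgroup_product_group[OF G lc H] by (simp add: P)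
  ultimately show ?thesis by blast
qed

end
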